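(* If $B\in\{0,1\}^{\mathbb{N}}$ is a full complexity word, i.e. every finite binary word occurs as a subword of $B$, then $B$ does not have a spacer rank construction.
   Context: Conventions: $\mathbb{N}$ is the set of nonnegative integers. A finite word is an element of $\bigcup_{m\ge 1}\{0,1\}^m$; an infinite word is an element of $\{0,1\}^{\mathbb{N}}$. Juxtaposition is concatenation and $1^a$ is $a$ consecutive $1$s. A finite subword of $V$ is a finite word of the form $V(i)V(i+1)\cdots V(i+k)$. Building: let $\mathcal{F}$ be the set of all finite words that start and end with $0$, and let $S\subset\mathcal{F}$ be finite. A finite word $w$ is built from $S$ if $w=v_11^{a_1}v_21^{a_2}\cdots v_k1^{a_k}v_{k+1}$ for some $k\ge 1$, $v_i\in S$, $a_i\in\mathbb{N}$; it is built from $S$ starting with $u$ if moreover one can take $v_1=u$. An infinite word $V$ has a spacer rank construction if there are a sequence $(n_i)_{i\ge0}$ of positive integers (not required to be bounded) and finite sets $S_i=\{v_{i,1},\dots,v_{i,n_i}\}\subset\mathcal{F}$ ($i\in\mathbb{N}$) such that: $v_{0,j}=0$ for all $1\le j\le n_0$; $v_{i+1,1}$ is built from $S_i$ starting with $v_{i,1}$; $v_{i+1,j}$ is built from $S_i$ for all $2\le j\le n_{i+1}$; and $v_{i,1}$ is an initial segment of $V$ for all $i\in\mathbb{N}$. *)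

theory Defs
  imports Main "HOL-Library.Z2"
begin

text \<open>
  The alphabet \<open>{0,1}\<close> is the two-element type \<^typ>\<open>bit\<close>. Lists over it include the empty list;
  finite words are the nonempty lists.
\<close>

type_synonym word = "bit list"
type_synonym infinite_word = "nat \<Rightarrow> bit"

definition finite_words :: "word set" where
  "finite_words = {w. w \<noteq> []}"

definition subword :: "word \<Rightarrow> infinite_word \<Rightarrow> bool" where
  "subword w V \<longleftrightarrow> (\<exists>i k. w = map V [i..<i + k + 1])"

definition initial_segment :: "word \<Rightarrow> infinite_word \<Rightarrow> bool" where
  "initial_segment w V \<longleftrightarrow> w = map V [0..<length w]"

definition zero_bounded_words :: "word set" (\<open>\<F>\<close>) where
  "\<F> = {w \<in> finite_words. hd w = 0 \<and> last w = 0}"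

text \<open>
  \<open>spaced_concat v a k\<close> is the word
  \<open>v\<^sub>1 1\<^bsup>a\<^sub>1\<^esup> v\<^sub>2 1\<^bsup>a\<^sub>2\<^esup> \<dots> v\<^sub>k 1\<^bsup>a\<^sub>k\<^esup> v\<^bsub>k+1\<^esub>\<close>; only the values
  \<open>v i\<close> for \<open>1 \<le> i \<le> k + 1\<close> and \<open>a i\<close> for \<open>1 \<le> i \<le> k\<close> matter.
\<close>

definition spaced_concat :: "(nat \<Rightarrow> word) \<Rightarrow> (nat \<Rightarrow> nat) \<Rightarrow> nat \<Rightarrow> word" where
  "spaced_concat v a k = concat (map (\<lambda>i. v i @ replicate (a i) 1) [1..<k + 1]) @ v (k + 1)"

definition built_from :: "word set \<Rightarrow> word \<Rightarrow> bool" where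
  "built_from S w \<longleftrightarrow>
     (\<exists>k v a. k \<ge> 1 \<and> (\<forall>i\<in>{1..k + 1}. v i \<in> S) \<and> w = spaced_concat v a k)"

definition built_from_starting :: "word set \<Rightarrow> word \<Rightarrow> word \<Rightarrow> bool" where
  "built_from_starting S u w \<longleftrightarrow>
     (\<exists>k v a. k \<ge> 1 \<and> (\<forall>i\<in>{1..k + 1}. v i \<in> S) \<and> v 1 = u \<and> w = spaced_concat v a k)"

text \<open>
  The set \<open>S\<^sub>i\<close> is \<open>v i ` {1..n i}\<close>, so the index \<open>j\<close> starts at 1 and repetitions are allowed;
  values \<open>v i j\<close> with \<open>j\<close> outside \<open>{1..n i}\<close> are irrelevant.
\<close>

definition spacer_rank_construction ::
  "(nat \<Rightarrow> nat) \<Rightarrow> (nat \<Rightarrow> nat \<Rightarrow> word) \<Rightarrow> infinite_word \<Rightarrow> bool" where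
  "spacer_rank_construction n v V \<longleftrightarrow>
     (\<forall>i. n i > 0) \<and>
     (\<forall>i. v i ` {1..n i} \<subseteq> \<F>) \<and>
     (\<forall>j\<in>{1..n 0}. v 0 j = [0]) \<and>
     (\<forall>i. built_from_starting (v i ` {1..n i}) (v i 1) (v (i + 1) 1)) \<and>
     (\<forall>i. \<forall>j\<in>{2..n (i + 1)}. built_from (v i ` {1..n i}) (v (i + 1) j)) \<and>
     (\<forall>i. initial_segment (v i 1) V)"

definition has_spacer_rank_construction :: "infinite_word \<Rightarrow> bool" where
  "has_spacer_rank_construction V \<longleftrightarrow> (\<exists>n v. spacer_rank_construction n v V)"

definition full_complexity :: "infinite_word \<Rightarrow> bool" where
  "full_complexity V \<longleftrightarrow> (\<forall>w\<in>finite_words. subword w V)"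

end

theory Submission
  imports Defs
begin

text \<open>
  A word in \<open>S\<^sub>1\<close> starts and ends with two different zeros, so if \<open>N\<close> bounds the lengths of
  the words in \<open>S\<^sub>1\<close>, then every zero of such a word has another zero within distance \<open>N\<close>. This
  property is inherited by everything built from \<open>S\<^sub>1\<close>, because spacers contribute no zeros;
  hence \<open>1\<^sup>N 0 1\<^sup>N\<close> cannot occur in the infinite word.
\<close>

text \<open>The two inequalities together express \<open>|p - q| \<le> N\<close> while avoiding
  truncated subtraction on the naturals.\<close>

definition zeros_clustered :: "nat \<Rightarrow> word \<Rightarrow> bool" where
  "zeros_clustered N w \<longleftrightarrow>
     (\<forall>p<length w. w ! p = 0 \<longrightarrow> (\<exists>q<length w. q \<noteq> p \<and> q \<le> p + N \<and> p \<le> q + N \<and> w ! q = 0))"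

lemma zeros_clustered_append:
  assumes "zeros_clustered N u" "zeros_clustered N w"
  shows "zeros_clustered N (u @ w)"
  unfolding zeros_clustered_def
proof (intro allI impI)
  fix p assume p: "p < length (u @ w)" "(u @ w) ! p = 0"
  show "\<exists>q<length (u @ w). q \<noteq> p \<and> q \<le> p + N \<and> p \<le> q + N \<and> (u @ w) ! q = 0"
  proof (cases "p < length u")
    case True
    with p assms(1) obtain q where "q < length u" "q \<noteq> p" "q \<le> p + N" "p \<le> q + N" "u ! q = 0"
      unfolding zeros_clustered_def by (auto simp: nth_append)
    then show ?thesis by (intro exI[of _ q]) (auto simp: nth_append)
  next
    case False
    with p have "p - length u < length w" "w ! (p - length u) = 0"
      by (auto simp: nth_append)
    with assms(2) obtain q where "q < length w" "q \<noteq> p - length u" "q \<le> p - length u + N"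
      "p - length u \<le> q + N" "w ! q = 0"
      unfolding zeros_clustered_def by blast
    with False show ?thesis by (intro exI[of _ "length u + q"]) (auto simp: nth_append)
  qed
qed

lemma zeros_clustered_replicate_1: "zeros_clustered N (replicate a 1)"
  by (simp add: zeros_clustered_def)

text \<open>The first letter is a partner for every zero but itself, and its own partner is the last
  letter; length at least 2 makes these two positions distinct.\<close>

lemma zeros_clustered_zero_bounded:
  assumes "w \<in> \<F>" "2 \<le> length w" "length w \<le> N"
  shows "zeros_clustered N w"
  unfolding zeros_clustered_def
proof (intro allI impI)
  fix p assume p: "p < length w" "w ! p = 0"
  have ends: "w ! 0 = 0" "w ! (length w - 1) = 0"
    using assms(1) by (auto simp: zero_bounded_words_def finite_words_def hd_conv_nth last_conv_nth)
  show "\<exists>q<length w. q \<noteq> p \<and> q \<le> p + N \<and> p \<le> q + N \<and> w ! q = 0"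
  proof (cases "p = 0")
    case True
    with ends assms show ?thesis by (intro exI[of _ "length w - 1"]) auto
  next
    case False
    with ends assms p show ?thesis by (intro exI[of _ 0]) auto
  qed
qed

text \<open>An induction principle for building: it carries a property such as
  \<open>zeros_clustered N\<close> from one level to the next.\<close>

lemma built_from_append_closed:
  assumes "built_from S w" "\<And>u. u \<in> S \<Longrightarrow> P u" "\<And>a. P (replicate a 1)"
    and append: "\<And>u v. P u \<Longrightarrow> P v \<Longrightarrow> P (u @ v)"
  shows "P w"
proof -
  from assms(1) obtain k v a where *: "\<forall>i\<in>{1..k + 1}. v i \<in> S" "w = spaced_concat v a k"
    unfolding built_from_def by blast
  have "P (concat (map (\<lambda>i. v i @ replicate (a i) 1) xs))" if "set xs \<subseteq> {1..k + 1}" for xs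
    using that
  proof (induction xs)
    case Nil
    \<comment> \<open>The empty word is the empty spacer, \<open>replicate 0 1\<close>.\<close>
    show ?case using assms(3)[of 0] by simp
  next
    case (Cons i xs)
    then have "v i \<in> S" using *(1) by auto
    with Cons assms(2,3) append show ?case by simp
  qed
  then have "P (concat (map (\<lambda>i. v i @ replicate (a i) 1) [1..<k + 1]))"
    by (simp del: upt_Suc add: subset_eq)
  moreover have "P (v (k + 1))" using *(1) assms(2) by simp
  ultimately show ?thesis unfolding *(2) spaced_concat_def by (rule append)
qed

lemma built_from_starting_imp_built_from:
  "built_from_starting S u w \<Longrightarrow> built_from S w"
  unfolding built_from_starting_def built_from_def by blast

text \<open>Since \<open>k \<ge> 1\<close>, the first and the last building block occupy disjoint
  parts of \<open>w\<close>.\<close>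

lemma built_from_length_ge:
  assumes "built_from S w" "\<And>u. u \<in> S \<Longrightarrow> m \<le> length u"
  shows "2 * m \<le> length w"
proof -
  from assms(1) obtain k v a where *: "k \<ge> 1" "\<forall>i\<in>{1..k + 1}. v i \<in> S" "w = spaced_concat v a k"
    unfolding built_from_def by blast
  have "[1..<k + 1] = 1 # [2..<k + 1]"
    using *(1) by (simp add: upt_rec numeral_2_eq_2)
  then have "length w \<ge> length (v 1) + length (v (k + 1))"
    by (simp add: *(3) spaced_concat_def)
  moreover have "m \<le> length (v 1)" "m \<le> length (v (k + 1))"
    using * assms(2) by auto
  ultimately show ?thesis by linarith
qed

context
  fixes n v V
  assumes construction: "spacer_rank_construction n v V"
begin

lemma level_built_from:
  assumes "w \<in> v (Suc i) ` {1..n (Suc i)}"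
  shows "built_from (v i ` {1..n i}) w"
proof -
  from assms obtain j where j: "1 \<le> j" "j \<le> n (i + 1)" "w = v (i + 1) j" by auto
  show ?thesis
  proof (cases "j = 1")
    case True
    with j construction show ?thesis
      by (auto simp: spacer_rank_construction_def intro: built_from_starting_imp_built_from)
  next
    case False
    with j have "j \<in> {2..n (i + 1)}" by auto
    with j construction show ?thesis unfolding spacer_rank_construction_def by blast
  qed
qed

text \<open>Lengths at least double at each level, and \<open>2 * (i + 1) \<ge> i + 2\<close>. This
  gives two letters at level 1 and lets the initial segments reach every position of
  \<open>V\<close>.\<close>

lemma level_length_gt: "w \<in> v i ` {1..n i} \<Longrightarrow> i < length w"
proof (induction i arbitrary: w)
  case 0
  with construction show ?case
    by (auto simp: spacer_rank_construction_def)
next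
  case (Suc i)
  from built_from_length_ge[OF level_built_from[OF Suc.prems], of "Suc i"] Suc.IH
  show ?case by (simp add: Suc_le_eq)
qed

text \<open>One \<open>N\<close>, the maximal length at level 1, serves all later levels, because
  building preserves clustering. The induction starts at level 1: the word \<open>[0]\<close> of
  level 0 has only one zero.\<close>

lemma level_zeros_clustered:
  obtains N where "\<And>i w. w \<in> v (Suc i) ` {1..n (Suc i)} \<Longrightarrow> zeros_clustered N w"
proof
  fix i w
  define N where "N = Max (length ` v 1 ` {1..n 1})"
  assume "w \<in> v (Suc i) ` {1..n (Suc i)}"
  then show "zeros_clustered (Max (length ` v 1 ` {1..n 1})) w"
    unfolding N_def[symmetric]
  proof (induction i arbitrary: w)
    case 0
    then have "w \<in> \<F>"
      using construction unfolding spacer_rank_construction_def by blast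
    moreover have "2 \<le> length w" using level_length_gt[OF 0] by simp
    moreover have "length w \<le> N" unfolding N_def using 0 by (intro Max_ge) auto
    ultimately show ?case by (rule zeros_clustered_zero_bounded)
  next
    case (Suc i)
    from level_built_from[OF Suc.prems] Suc.IH zeros_clustered_replicate_1 zeros_clustered_append
    show ?case by (rule built_from_append_closed)
  qed
qed

lemma zero_has_close_zero:
  obtains N where "\<And>p. V p = 0 \<Longrightarrow> \<exists>q. q \<noteq> p \<and> q \<le> p + N \<and> p \<le> q + N \<and> V q = 0"
proof -
  obtain N where N: "\<And>i w. w \<in> v (Suc i) ` {1..n (Suc i)} \<Longrightarrow> zeros_clustered N w"
    using level_zeros_clustered by blast
  have "\<exists>q. q \<noteq> p \<and> q \<le> p + N \<and> p \<le> q + N \<and> V q = 0" if "V p = 0" for p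
  proof -
    \<comment> \<open>Level \<open>Suc p\<close> is past level 0, so clustering applies, and its
      words are long enough to contain position \<open>p\<close>.\<close>
    let ?w = "v (Suc p) 1"
    have "n (Suc p) > 0" and "initial_segment ?w V"
      using construction by (auto simp: spacer_rank_construction_def)
    then have w: "?w \<in> v (Suc p) ` {1..n (Suc p)}" and eq: "?w = map V [0..<length ?w]"
      by (auto simp: initial_segment_def)
    have nth: "?w ! q = V q" if "q < length ?w" for q
      using that by (subst eq) simp
    have "p < length ?w" using level_length_gt[OF w] by simp
    with N[OF w] nth that show ?thesis unfolding zeros_clustered_def by metis
  qed
  with that show ?thesis by blast
qed

end

theorem corollary2p7:
  fixes B :: infinite_word
  assumes "full_complexity B"
  shows "\<not> has_spacer_rank_construction B"
proof
  assume "has_spacer_rank_construction B"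
  then obtain n v where "spacer_rank_construction n v B"
    unfolding has_spacer_rank_construction_def by blast
  then obtain N where N: "\<And>p. B p = 0 \<Longrightarrow> \<exists>q. q \<noteq> p \<and> q \<le> p + N \<and> p \<le> q + N \<and> B q = 0"
    by (rule zero_has_close_zero) blast
  \<comment> \<open>The central zero has only ones within distance \<open>N\<close> on both
    sides.\<close>
  let ?w = "replicate N 1 @ 0 # replicate N 1 :: word"
  have "subword ?w B"
    using assms by (simp add: full_complexity_def finite_words_def)
  then obtain i k where ik: "?w = map B [i..<i + k + 1]"
    unfolding subword_def by blast
  from arg_cong[OF ik, of length] have k: "k = 2 * N" by simp
  have B: "B (i + r) = ?w ! r" if "r \<le> 2 * N" for r
    using that k by (subst ik) (simp del: upt_Suc)
  from B[of N] have "B (i + N) = 0" by (simp add: nth_append)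
  from N[OF this] obtain q where q: "q \<noteq> i + N" "q \<le> i + N + N" "i + N \<le> q + N" "B q = 0"
    by blast
  \<comment> \<open>The distance bounds give \<open>i \<le> q \<le> i + 2 * N\<close>, so
    \<open>q\<close> lies inside this occurrence of the word.\<close>
  then have "?w ! (q - i) = 0" using B[of "q - i"] by auto
  moreover have "?w ! (q - i) = 1"
    using q by (cases "q - i < N") (auto simp: nth_append nth_Cons split: nat.split)
  ultimately show False by simp
qed

end
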